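(* Let $u\in C_{+,1/2}$ be (log, $x^2$)-convex. Then the functions $\mathcal L_{u^*}$ and $\mathcal L_u^{\#}$ are equivalent.
   Context: $C_{+,\log}$ denotes the set of all positive continuous functions $u:[0,\infty)\to(0,\infty)$ with $\lim_{r\to\infty}\frac{\log u(r)}{\log r}=\infty$, and $C_{+,1/2}$ the set of all positive continuous functions $u$ on $[0,\infty)$ with $\lim_{r\to\infty}\frac{\log u(r)}{\sqrt r}=\infty$; thus $C_{+,1/2}\subset C_{+,\log}$. For $u\in C_{+,\log}$ the Legendre transform is $\ell_u(t)=\inf_{r>0}\frac{u(r)}{r^t}$, $t\in[0,\infty)$, and the $L$-function is $\mathcal L_u(r)=\sum_{n=0}^\infty\ell_u(n)r^n$, $r\ge0$ (defined when $\ell_u(n)^{1/n}\to0$). For $u\in C_{+,1/2}$ the dual Legendre function is $u^*(r)=\sup_{s>0}\frac{e^{2\sqrt{rs}}}{u(s)}$, $r\ge0$, which again belongs to $C_{+,1/2}$; and the $L^{\#}$-function is $\mathcal L_u^{\#}(r)=\sum_{n=0}^\infty\frac{1}{\ell_u(n)(n!)^2}r^n$, $r\ge0$ (defined when $(\ell_u(n)(n!)^2)^{-1/n}\to0$). Both $\mathcal L_{u^*}$ and $\mathcal L_u^{\#}$ are defined (entire) when $u\in C_{+,1/2}$ is (log, $x^2$)-convex. A positive continuous function $u$ on $[0,\infty)$ is (log, $x^2$)-convex if $x\mapsto\log u(x^2)$ is convex on $[0,\infty)$. Two positive functions $f,g$ on $[0,\infty)$ are equivalent if there exist positive constants $c_1,c_2,a_1,a_2$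 such that $c_1f(a_1r)\le g(r)\le c_2f(a_2r)$ for all $r\ge0$. *)

theory Defs
  imports "HOL-Analysis.Analysis"
begin

text \<open>Functions on \<open>[0,\<infinity>)\<close> are total functions on the reals; only their values on
  \<open>{0..}\<close> are ever used.\<close>

definition C_plus_half :: "(real \<Rightarrow> real) set" where
  "C_plus_half = {u. continuous_on {0..} u \<and> (\<forall>r\<ge>0. 0 < u r) \<and>
     filterlim (\<lambda>r. ln (u r) / sqrt r) at_top at_top}"

definition log_x2_convex :: "(real \<Rightarrow> real) \<Rightarrow> bool" where
  "log_x2_convex u \<longleftrightarrow> continuous_on {0..} u \<and> (\<forall>r\<ge>0. 0 < u r) \<and>
     convex_on {0..} (\<lambda>x. ln (u (x\<^sup>2)))"

definition legendre :: "(real \<Rightarrow> real) \<Rightarrow> real \<Rightarrow> real" where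
  "legendre u t = (INF r\<in>{0<..}. u r / r powr t)"

definition dual_legendre :: "(real \<Rightarrow> real) \<Rightarrow> real \<Rightarrow> real" where
  "dual_legendre u r = (SUP s\<in>{0<..}. exp (2 * sqrt (r * s)) / u s)"

definition L_fun :: "(real \<Rightarrow> real) \<Rightarrow> real \<Rightarrow> real" where
  "L_fun u r = (\<Sum>n. legendre u (real n) * r ^ n)"

definition L_sharp :: "(real \<Rightarrow> real) \<Rightarrow> real \<Rightarrow> real" where
  "L_sharp u r = (\<Sum>n. 1 / (legendre u (real n) * (fact n)\<^sup>2) * r ^ n)"

definition equivalent_funs :: "(real \<Rightarrow> real) \<Rightarrow> (real \<Rightarrow> real) \<Rightarrow> bool" where
  "equivalent_funs f g \<longleftrightarrow> (\<forall>r\<ge>0. 0 < f r) \<and> (\<forall>r\<ge>0. 0 < g r) \<and>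
     (\<exists>c1>0. \<exists>c2>0. \<exists>a1>0. \<exists>a2>0. \<forall>r\<ge>0. c1 * f (a1 * r) \<le> g r \<and> g r \<le> c2 * f (a2 * r))"

text \<open>The infima, suprema and series above are genuine for the functions they are applied to,
  i.e. the totalised operators never return default values.\<close>

lemma C_plus_half_growth:
  assumes u: "u \<in> C_plus_half"
  shows "\<exists>c>0. \<forall>s\<ge>0. c * exp (K * sqrt s) \<le> u s"
proof -
  have cont: "continuous_on {0..} u" and pos: "\<And>r. r \<ge> 0 \<Longrightarrow> 0 < u r"
    and lim: "filterlim (\<lambda>r. ln (u r) / sqrt r) at_top at_top"
    using u by (auto simp: C_plus_half_def)
  from lim have "eventually (\<lambda>r. K \<le> ln (u r) / sqrt r) at_top"
    by (simp add: filterlim_at_top)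
  then obtain S0 where S0: "\<And>r. r \<ge> S0 \<Longrightarrow> K \<le> ln (u r) / sqrt r"
    by (auto simp: eventually_at_top_linorder)
  define S where "S = max S0 1"
  have large: "exp (K * sqrt s) \<le> u s" if "s \<ge> S" for s
  proof -
    have s: "s \<ge> S0" "s \<ge> 1" using that by (auto simp: S_def)
    then have "K * sqrt s \<le> ln (u s)" using S0[OF s(1)] by (simp add: pos_le_divide_eq)
    then show ?thesis using pos[of s] s by (simp add: ln_ge_iff)
  qed
  define h where "h = (\<lambda>s. u s * exp (- (K * sqrt s)))"
  have "continuous_on {0..S} h"
    unfolding h_def by (intro continuous_intros continuous_on_subset[OF cont]) auto
  moreover have "{0..S} \<noteq> {}" by (auto simp: S_def)
  ultimately obtain m where m: "m \<in> {0..S}" "\<And>s. s \<in> {0..S} \<Longrightarrow> h m \<le> h s"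
    using continuous_attains_inf[of "{0..S}" h] by auto
  have hm: "0 < h m" using m(1) pos[of m] by (simp add: h_def)
  define c where "c = min (h m) 1"
  have "c * exp (K * sqrt s) \<le> u s" if "s \<ge> 0" for s
  proof (cases "s \<le> S")
    case True
    then have "c \<le> u s * exp (- (K * sqrt s))" using m(2)[of s] that by (auto simp: c_def h_def)
    then have "c * exp (K * sqrt s) \<le> u s * exp (- (K * sqrt s)) * exp (K * sqrt s)"
      by (rule mult_right_mono) simp
    then show ?thesis by (simp add: exp_minus mult.assoc)
  next
    case False
    have "c * exp (K * sqrt s) \<le> 1 * exp (K * sqrt s)"
      by (rule mult_right_mono) (auto simp: c_def)
    then show ?thesis using large[of s] False by linarith
  qed
  moreover have "c > 0" using hm by (simp add: c_def)
  ultimately show ?thesis by blast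
qed

lemma bdd_below_legendre:
  fixes u :: "real \<Rightarrow> real"
  assumes "\<And>r. r \<ge> 0 \<Longrightarrow> 0 < u r"
  shows "bdd_below ((\<lambda>r. u r / r powr t) ` {0<..})"
  by (intro bdd_belowI[of _ 0]) (auto simp: assms less_imp_le)

lemma bdd_above_dual_legendre:
  assumes u: "u \<in> C_plus_half" and r: "r \<ge> 0"
  shows "bdd_above ((\<lambda>s. exp (2 * sqrt (r * s)) / u s) ` {0<..})"
proof -
  obtain c where c: "c > 0" "\<And>s. s \<ge> 0 \<Longrightarrow> c * exp (2 * sqrt r * sqrt s) \<le> u s"
    using C_plus_half_growth[OF u, of "2 * sqrt r"] by blast
  have "exp (2 * sqrt (r * s)) / u s \<le> 1 / c" if s: "s > 0" for s
  proof -
    have "0 < u s" using u s by (auto simp: C_plus_half_def)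
    then show ?thesis using c(2)[of s] c(1) s
      by (simp add: field_simps real_sqrt_mult)
  qed
  then show ?thesis by (intro bdd_aboveI[of _ "1 / c"]) auto
qed

lemma dual_legendre_pos:
  assumes u: "u \<in> C_plus_half" and r: "r \<ge> 0"
  shows "0 < dual_legendre u r"
proof -
  have "0 < u 1" using u by (auto simp: C_plus_half_def)
  then have "0 < exp (2 * sqrt (r * 1)) / u 1" by simp
  also have "\<dots> \<le> dual_legendre u r" unfolding dual_legendre_def
    by (rule cSUP_upper[OF _ bdd_above_dual_legendre[OF u r]]) simp
  finally show ?thesis .
qed

lemma summable_L_fun:
  assumes pos: "\<And>r. r \<ge> 0 \<Longrightarrow> 0 < u r"
  shows "summable (\<lambda>n. legendre u (real n) * r ^ n)"
proof -
  define R where "R = 2 * \<bar>r\<bar> + 1"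
  have R: "R > 0" by (simp add: R_def)
  have nonneg: "0 \<le> legendre u t" for t unfolding legendre_def
    by (rule cINF_greatest) (auto simp: pos less_imp_le)
  have le: "legendre u (real n) \<le> u R / R ^ n" for n
    using cINF_lower[OF bdd_below_legendre[of u "real n", OF pos], of R] R
    by (simp add: legendre_def powr_realpow)
  have bound: "norm (legendre u (real n) * r ^ n) \<le> u R * (\<bar>r\<bar> / R) ^ n" for n
  proof -
    have "norm (legendre u (real n) * r ^ n) = legendre u (real n) * \<bar>r\<bar> ^ n"
      using nonneg by (simp add: abs_mult power_abs)
    also have "\<dots> \<le> u R / R ^ n * \<bar>r\<bar> ^ n"
      by (rule mult_right_mono[OF le]) simp
    finally show ?thesis by (simp add: power_divide)
  qed
  have "norm (\<bar>r\<bar> / R) < 1" using R by (simp add: R_def)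
  then have "summable (\<lambda>n. u R * (\<bar>r\<bar> / R) ^ n)"
    by (intro summable_mult summable_geometric)
  then show ?thesis by (rule summable_comparison_test'[where N = 0]) (rule bound)
qed

lemma summable_L_sharp:
  assumes u: "u \<in> C_plus_half"
  shows "summable (\<lambda>n. 1 / (legendre u (real n) * (fact n)\<^sup>2) * r ^ n)"
proof -
  define q where "q = 2 * \<bar>r\<bar> + 1"
  have q: "q > 0" by (simp add: q_def)
  obtain c where c: "c > 0" "\<And>s. s \<ge> 0 \<Longrightarrow> c * exp (2 * sqrt q * sqrt s) \<le> u s"
    using C_plus_half_growth[OF u, of "2 * sqrt q"] by blast
  have le: "c * q ^ n \<le> legendre u (real n) * (fact n)\<^sup>2" for n
  proof -
    have "c * q ^ n / (fact n)\<^sup>2 \<le> u s / s powr real n" if s: "s > 0" for s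
    proof -
      have "(sqrt q * sqrt s) ^ n / fact n \<le> exp (sqrt q * sqrt s)"
      proof -
        have "(\<Sum>k\<in>{n}. (sqrt q * sqrt s) ^ k /\<^sub>R fact k) \<le> (\<Sum>k. (sqrt q * sqrt s) ^ k /\<^sub>R fact k)"
          using q s by (intro sum_le_suminf summable_exp_generic) (auto simp: less_imp_le)
        then show ?thesis by (simp add: exp_def divide_inverse mult.commute)
      qed
      then have "((sqrt q * sqrt s) ^ n / fact n)\<^sup>2 \<le> (exp (sqrt q * sqrt s))\<^sup>2"
        using q s by (intro power_mono) auto
      moreover have "((sqrt q * sqrt s) ^ n / fact n)\<^sup>2 = q ^ n * s ^ n / (fact n)\<^sup>2"
      proof -
        have "((sqrt q * sqrt s) ^ n)\<^sup>2 = ((sqrt q)\<^sup>2) ^ n * ((sqrt s)\<^sup>2) ^ n"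
          by (simp add: power_mult_distrib power_mult[symmetric] mult.commute)
        then show ?thesis using q s by (simp add: power_divide)
      qed
      moreover have "(exp (sqrt q * sqrt s))\<^sup>2 = exp (2 * sqrt q * sqrt s)"
        by (simp add: power2_eq_square exp_add[symmetric])
      ultimately have "q ^ n * s ^ n / (fact n)\<^sup>2 \<le> exp (2 * sqrt q * sqrt s)" by simp
      then have "c * (q ^ n * s ^ n / (fact n)\<^sup>2) \<le> u s"
        using c(2)[of s] c(1) s by (meson less_imp_le mult_left_mono order_trans)
      then show ?thesis using s by (simp add: powr_realpow field_simps)
    qed
    then have "c * q ^ n / (fact n)\<^sup>2 \<le> legendre u (real n)"
      unfolding legendre_def by (intro cINF_greatest) auto
    then show ?thesis by (simp add: field_simps)
  qed
  have bound: "norm (1 / (legendre u (real n) * (fact n)\<^sup>2) * r ^ n) \<le> 1 / c * (\<bar>r\<bar> / q) ^ n" for n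
  proof -
    have p: "0 < c * q ^ n" using c(1) q by simp
    then have p': "0 < legendre u (real n) * (fact n)\<^sup>2" using le[of n] by linarith
    have "norm (1 / (legendre u (real n) * (fact n)\<^sup>2) * r ^ n)
        = 1 / (legendre u (real n) * (fact n)\<^sup>2) * \<bar>r\<bar> ^ n"
      unfolding real_norm_def abs_mult power_abs abs_divide using abs_of_pos[OF p']
      by (simp add: abs_mult)
    also have "\<dots> \<le> 1 / (c * q ^ n) * \<bar>r\<bar> ^ n"
      by (intro mult_right_mono divide_left_mono le) (use p p' in auto)
    finally show ?thesis by (simp add: power_divide)
  qed
  have "norm (\<bar>r\<bar> / q) < 1" using q by (simp add: q_def)
  then have "summable (\<lambda>n. 1 / c * (\<bar>r\<bar> / q) ^ n)"
    by (intro summable_mult summable_geometric)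
  then show ?thesis by (rule summable_comparison_test'[where N = 0]) (rule bound)
qed

end

theory Submission
  imports Defs "HOL-Real_Asymp.Real_Asymp"
begin

text \<open>
  Both functions are power series with positive coefficients: write \<open>a\<^sub>n = \<ell>\<^bsub>u*\<^esub>(n)\<close> for those of
  \<open>L_fun (dual_legendre u)\<close> and \<open>b\<^sub>n = 1 / (\<ell>\<^sub>u(n) (n!)\<^sup>2)\<close> for those of \<open>L_sharp u\<close>. Rescaling the
  argument by \<open>q\<close> multiplies the \<open>n\<close>-th coefficient by \<open>q\<^sup>n\<close>, so the equivalence follows once
  \<open>b\<^sub>n \<le> a\<^sub>n \<le> C q\<^sup>n b\<^sub>n\<close> is known (\<open>equivalent_power_series\<close>); here \<open>q = e\<^sup>2\<close>.

  The lower bound \<open>b\<^sub>n \<le> a\<^sub>n\<close> is weak duality. A single term of the exponential series gives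
  \<open>e\<^bsup>2\<surd>(rs)\<^esup> \<ge> (rs)\<^sup>n / (n!)\<^sup>2\<close>; dividing by \<open>u(s) r\<^sup>n\<close> and optimising over \<open>s\<close> and then over \<open>r\<close>
  yields the claim (\<open>legendre_dual_ge\<close>).

  The upper bound is strong duality, and it is here that convexity enters. Put \<open>f(x) = ln u(x\<^sup>2)\<close>.
  For \<open>n \<ge> 1\<close> the function \<open>f(x) - 2n ln x\<close> attains its minimum at some \<open>x\<^sub>0 > 0\<close>. There \<open>2n/x\<^sub>0\<close>
  is a subgradient of the convex function \<open>f\<close>, that is,
  \<open>f(x) \<ge> f(x\<^sub>0) + 2n (x/x\<^sub>0 - 1)\<close> for all \<open>x > 0\<close> (\<open>convex_tangent_at_log_min\<close>). This says that for
  \<open>r = (n/x\<^sub>0)\<^sup>2\<close> the supremum \<open>u*(r) = sup\<^sub>x exp(2x\<surd>r - f(x))\<close> is attained at \<open>x = x\<^sub>0\<close>, and inserting this \<open>r\<close>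
  into the infimum defining \<open>a\<^sub>n\<close> gives \<open>\<ell>\<^sub>u(n) a\<^sub>n \<le> (e/n)\<^bsup>2n\<^esup> \<le> e\<^bsup>2n\<^esup> / (n!)\<^sup>2\<close>
  (\<open>legendre_mult_legendre_dual_le\<close>). The coefficient with \<open>n = 0\<close> is absorbed by the constant \<open>C\<close>.
\<close>

lemma C_plus_half_pos: "u \<in> C_plus_half \<Longrightarrow> r \<ge> 0 \<Longrightarrow> 0 < u r"
  by (simp add: C_plus_half_def)

lemma legendre_le:
  assumes "\<And>r. r \<ge> 0 \<Longrightarrow> 0 < u r" and "r > 0"
  shows "legendre u (real n) \<le> u r / r ^ n"
  using cINF_lower[OF bdd_below_legendre[of u "real n", OF assms(1)], of r] assms(2)
  by (simp add: legendre_def powr_realpow)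

lemma legendre_greatest:
  assumes "\<And>r. r > 0 \<Longrightarrow> m \<le> u r / r ^ n"
  shows "m \<le> legendre u (real n)"
  unfolding legendre_def using assms by (intro cINF_greatest) (auto simp: powr_realpow)

lemma power_div_fact_square_le_exp_sqrt:
  fixes x :: real
  assumes "x \<ge> 0"
  shows "x ^ n / (fact n)\<^sup>2 \<le> exp (2 * sqrt x)"
proof -
  have "(\<Sum>k\<in>{n}. sqrt x ^ k /\<^sub>R fact k) \<le> (\<Sum>k. sqrt x ^ k /\<^sub>R fact k)"
    using assms by (intro sum_le_suminf summable_exp_generic) auto
  then have "sqrt x ^ n / fact n \<le> exp (sqrt x)"
    by (simp add: exp_def divide_inverse mult.commute)
  then have "(sqrt x ^ n / fact n)\<^sup>2 \<le> (exp (sqrt x))\<^sup>2"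
    using assms by (intro power_mono) auto
  moreover have "(sqrt x ^ n / fact n)\<^sup>2 = x ^ n / (fact n)\<^sup>2"
  proof -
    have "(sqrt x ^ n)\<^sup>2 = ((sqrt x)\<^sup>2) ^ n"
      by (rule trans[OF power_even_eq[symmetric] power_mult])
    then show ?thesis using assms by (simp add: power_divide)
  qed
  moreover have "(exp (sqrt x))\<^sup>2 = exp (2 * sqrt x)"
    by (simp add: power2_eq_square exp_add[symmetric])
  ultimately show ?thesis by simp
qed

lemma legendre_pos:
  assumes u: "u \<in> C_plus_half"
  shows "0 < legendre u (real n)"
proof -
  obtain c where c: "c > 0" "\<And>s. s \<ge> 0 \<Longrightarrow> c * exp (2 * sqrt s) \<le> u s"
    using C_plus_half_growth[OF u, of 2] by blast
  have "c / (fact n)\<^sup>2 \<le> u s / s ^ n" if "s > 0" for s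
  proof -
    have "c * (s ^ n / (fact n)\<^sup>2) \<le> c * exp (2 * sqrt s)"
      using that c(1) by (intro mult_left_mono power_div_fact_square_le_exp_sqrt) auto
    then have "c * (s ^ n / (fact n)\<^sup>2) \<le> u s" using c(2)[of s] that by simp
    then show ?thesis using that by (simp add: field_simps)
  qed
  then have "c / (fact n)\<^sup>2 \<le> legendre u (real n)" by (rule legendre_greatest)
  moreover have "0 < c / (fact n)\<^sup>2" using c(1) by simp
  ultimately show ?thesis by linarith
qed

text \<open>Weak duality: the bound \<open>e\<^bsup>2\<surd>(rs)\<^esup> \<ge> (rs)\<^sup>n / (n!)\<^sup>2\<close> separates the variables \<open>r\<close> and \<open>s\<close>, so
  the two extremal problems decouple.\<close>

lemma legendre_dual_ge:
  assumes u: "u \<in> C_plus_half"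
  shows "1 / (legendre u (real n) * (fact n)\<^sup>2) \<le> legendre (dual_legendre u) (real n)"
proof (rule legendre_greatest)
  fix r :: real assume r: "r > 0"
  have D: "0 < dual_legendre u r" using dual_legendre_pos[OF u] r by simp
  have "r ^ n / ((fact n)\<^sup>2 * dual_legendre u r) \<le> u s / s ^ n" if s: "s > 0" for s
  proof -
    have us: "0 < u s" using C_plus_half_pos[OF u] s by simp
    have "(r * s) ^ n / (fact n)\<^sup>2 / u s \<le> exp (2 * sqrt (r * s)) / u s"
      using r s us by (intro divide_right_mono power_div_fact_square_le_exp_sqrt) auto
    also have "\<dots> \<le> dual_legendre u r" unfolding dual_legendre_def
      using s r by (intro cSUP_upper[OF _ bdd_above_dual_legendre[OF u]]) auto
    finally show ?thesis using us s D by (simp add: field_simps)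
  qed
  then have "r ^ n / ((fact n)\<^sup>2 * dual_legendre u r) \<le> legendre u (real n)"
    by (rule legendre_greatest)
  then show "1 / (legendre u (real n) * (fact n)\<^sup>2) \<le> dual_legendre u r / r ^ n"
    using legendre_pos[OF u, of n] D r by (simp add: field_simps)
qed

text \<open>For \<open>n \<ge> 1\<close> the quotient \<open>u r / r\<^sup>n\<close> blows up at \<open>0\<close>, because \<open>u\<close> is bounded away from \<open>0\<close>, and
  at infinity, because \<open>u\<close> grows faster than \<open>e\<^bsup>\<surd>r\<^esup>\<close>; hence it is minimised on a compact
  interval.\<close>

lemma legendre_minimizer_exists:
  assumes u: "u \<in> C_plus_half" and n: "n \<ge> 1"
  shows "\<exists>r0>0. \<forall>r>0. u r0 / r0 ^ n \<le> u r / r ^ n"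
proof -
  note pos = C_plus_half_pos[OF u]
  have u1: "0 < u 1" using pos by simp
  obtain c where c: "c > 0" "\<And>s. s \<ge> 0 \<Longrightarrow> c * exp (0 * sqrt s) \<le> u s"
    using C_plus_half_growth[OF u, of 0] by blast
  obtain d where d: "d > 0" "\<And>s. s \<ge> 0 \<Longrightarrow> d * exp (1 * sqrt s) \<le> u s"
    using C_plus_half_growth[OF u, of 1] by blast
  have "eventually (\<lambda>r::real. ln (u 1 / d) + real n * ln r \<le> sqrt r) at_top"
    by real_asymp
  then obtain B where B: "\<And>r. r \<ge> B \<Longrightarrow> ln (u 1 / d) + real n * ln r \<le> sqrt r"
    by (auto simp: eventually_at_top_linorder)
  \<comment> \<open>Outside \<open>[A, max B 1]\<close> the quotient is at least its value \<open>u 1\<close> at the point \<open>1\<close>.\<close>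
  define A where "A = min (c / u 1) 1"
  have A: "0 < A" "A \<le> 1" using c(1) u1 by (auto simp: A_def)
  have small: "u 1 \<le> u r / r ^ n" if r: "0 < r" "r \<le> A" for r
  proof -
    have "r ^ n \<le> r ^ 1" using r A n by (intro power_decreasing) auto
    also have "\<dots> \<le> c / u 1" using r by (simp add: A_def)
    finally have "u 1 * r ^ n \<le> c" using u1 by (simp add: field_simps)
    also have "\<dots> \<le> u r" using c(2)[of r] r by simp
    finally show ?thesis using r by (simp add: field_simps)
  qed
  have large: "u 1 \<le> u r / r ^ n" if r: "r \<ge> max B 1" for r
  proof -
    have "u 1 / d * r ^ n = exp (ln (u 1 / d) + real n * ln r)"
      using u1 d(1) r by (simp add: exp_add exp_of_nat_mult)
    also have "\<dots> \<le> exp (sqrt r)" using B[of r] r by simp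
    finally have "u 1 * r ^ n \<le> d * exp (sqrt r)" using d(1) by (simp add: field_simps)
    also have "\<dots> \<le> u r" using d(2)[of r] r by simp
    finally show ?thesis using r by (simp add: field_simps)
  qed
  have "continuous_on {0..} u" using u by (simp add: C_plus_half_def)
  then have cont_u: "continuous_on {A..max B 1} u"
    by (rule continuous_on_subset) (use A in auto)
  have "continuous_on {A..max B 1} (\<lambda>r. u r / r ^ n)"
    using A by (intro continuous_on_divide continuous_on_power continuous_on_id cont_u) auto
  moreover have "{A..max B 1} \<noteq> {}" using A by auto
  ultimately obtain r0 where r0: "r0 \<in> {A..max B 1}"
      "\<And>r. r \<in> {A..max B 1} \<Longrightarrow> u r0 / r0 ^ n \<le> u r / r ^ n"
    using continuous_attains_inf[of "{A..max B 1}" "\<lambda>r. u r / r ^ n"] by auto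
  have "u r0 / r0 ^ n \<le> u 1" using r0(2)[of 1] A by simp
  then have "u r0 / r0 ^ n \<le> u r / r ^ n" if "r > 0" for r
    using order_trans[OF _ small] order_trans[OF _ large] r0(2)[of r] that
    by (metis atLeastAtMost_iff linorder_le_cases)
  then show ?thesis using r0(1) A by (intro exI[of _ r0]) auto
qed

text \<open>If \<open>f - a ln\<close> is minimal at \<open>x0\<close>, then \<open>f\<close> lies above \<open>f x0 + a ln (x / x0)\<close>. On a small segment
  issuing from \<open>x0\<close> this lower bound has slope \<open>a / x0\<close> to first order, and convexity
  propagates the resulting bound on the difference quotients of \<open>f\<close> to the whole half-line.\<close>

lemma convex_tangent_at_log_min:
  fixes f :: "real \<Rightarrow> real"
  assumes conv: "convex_on {0<..} f" and x0: "x0 > 0" and x: "x > 0"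
    and minimum: "\<And>y. y > 0 \<Longrightarrow> f x0 - a * ln x0 \<le> f y - a * ln y"
  shows "f x0 + a * (x / x0 - 1) \<le> f x"
proof -
  define h where "h = x / x0 - 1"
  have "((\<lambda>t. a * ln (1 + t * h) / t) \<longlongrightarrow> a * h) (at_right 0)"
    by real_asymp
  moreover have "eventually (\<lambda>t::real. a * ln (1 + t * h) / t \<le> f x - f x0) (at_right 0)"
    using eventually_at_right_less[of 0] eventually_at_right_real[of 0 1, simplified]
  proof eventually_elim
    case (elim t)
    define y where "y = (1 - t) * x0 + t * x"
    have y: "y > 0" unfolding y_def using elim x0 x by (intro add_pos_pos mult_pos_pos) auto
    have "1 + t * h = y / x0" using x0 by (simp add: h_def y_def field_simps)
    then have "a * ln (1 + t * h) = a * ln y - a * ln x0"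
      using y x0 by (simp add: ln_div right_diff_distrib)
    also have "\<dots> \<le> f y - f x0" using minimum[OF y] by simp
    also have "f y \<le> (1 - t) * f x0 + t * f x"
      using convex_onD[OF conv, of t x0 x] elim x0 x by (simp add: y_def)
    finally have "a * ln (1 + t * h) \<le> t * (f x - f x0)" by (simp add: algebra_simps)
    then show ?case using elim by (simp add: field_simps)
  qed
  ultimately have "a * h \<le> f x - f x0"
    by (rule tendsto_upperbound) simp
  then show ?thesis by (simp add: h_def)
qed

text \<open>Strong duality: the slope of \<open>x \<mapsto> ln u(x\<^sup>2)\<close> at the square root of the minimiser \<open>r0\<close> of
  \<open>u r / r\<^sup>n\<close> picks out the argument \<open>n\<^sup>2 / r0\<close> at which the dual problem is solved.\<close>

lemma legendre_mult_legendre_dual_le: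
  assumes u: "u \<in> C_plus_half" and conv: "log_x2_convex u" and n: "n \<ge> 1"
  shows "legendre u (real n) * legendre (dual_legendre u) (real n) \<le> exp 2 ^ n / (real n ^ n)\<^sup>2"
proof -
  note pos = C_plus_half_pos[OF u]
  obtain r0 where r0: "r0 > 0" "\<And>r. r > 0 \<Longrightarrow> u r0 / r0 ^ n \<le> u r / r ^ n"
    using legendre_minimizer_exists[OF u n] by blast
  define f where "f = (\<lambda>x. ln (u (x\<^sup>2)))"
  have conv_f: "convex_on {0<..} f"
    using conv unfolding log_x2_convex_def f_def by (auto intro: convex_on_subset)
  have minimum: "f (sqrt r0) - real (2 * n) * ln (sqrt r0) \<le> f y - real (2 * n) * ln y"
    if y: "y > 0" for y
  proof -
    have "ln (u r0 / r0 ^ n) \<le> ln (u (y\<^sup>2) / (y\<^sup>2) ^ n)"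
      using r0 y pos[of r0] pos[of "y\<^sup>2"] by (subst ln_le_cancel_iff) auto
    then show ?thesis
      using r0(1) y pos[of r0] pos[of "y\<^sup>2"]
      by (simp add: f_def ln_div ln_realpow ln_sqrt)
  qed
  define r where "r = (real n)\<^sup>2 / r0"
  have r: "r > 0" using r0(1) n by (simp add: r_def)
  have ur0: "0 < u r0" using pos r0(1) by simp
  have "dual_legendre u r \<le> exp (2 * real n) / u r0"
    unfolding dual_legendre_def
  proof (rule cSUP_least)
    fix s :: real assume s: "s \<in> {0<..}"
    then have us: "0 < u s" using pos by simp
    have "f (sqrt r0) + real (2 * n) * (sqrt s / sqrt r0 - 1) \<le> f (sqrt s)"
      using r0(1) s by (intro convex_tangent_at_log_min[OF conv_f _ _ minimum]) auto
    moreover have "sqrt (r * s) = real n * (sqrt s / sqrt r0)"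
      by (simp add: r_def real_sqrt_mult real_sqrt_divide)
    ultimately have "2 * sqrt (r * s) - ln (u s) \<le> 2 * real n - ln (u r0)"
      using r0(1) s by (simp add: f_def algebra_simps)
    then have "exp (2 * sqrt (r * s) - ln (u s)) \<le> exp (2 * real n - ln (u r0))"
      by simp
    then show "exp (2 * sqrt (r * s)) / u s \<le> exp (2 * real n) / u r0"
      using us ur0 by (simp add: exp_diff)
  qed simp
  then have "dual_legendre u r / r ^ n \<le> exp (2 * real n) / u r0 / r ^ n"
    using r by (intro divide_right_mono) auto
  moreover have "legendre (dual_legendre u) (real n) \<le> dual_legendre u r / r ^ n"
    using r by (intro legendre_le dual_legendre_pos[OF u])
  ultimately have "legendre (dual_legendre u) (real n) \<le> exp (2 * real n) / u r0 / r ^ n"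
    by linarith
  moreover have dual_nonneg: "0 \<le> legendre (dual_legendre u) (real n)"
    using legendre_pos[OF u, of n] by (intro order_trans[OF _ legendre_dual_ge[OF u]]) simp
  ultimately have "legendre u (real n) * legendre (dual_legendre u) (real n)
      \<le> u r0 / r0 ^ n * (exp (2 * real n) / u r0 / r ^ n)"
    using r0(1) ur0 legendre_le[of u, OF pos r0(1)] dual_nonneg by (intro mult_mono) auto
  also have "\<dots> = exp (2 * real n) / (r0 * r) ^ n"
    using ur0 by (simp add: power_mult_distrib)
  also have "r0 * r = (real n)\<^sup>2" using r0(1) by (simp add: r_def)
  also have "exp (2 * real n) = exp 2 ^ n" by (rule exp_of_nat2_mult)
  also have "((real n)\<^sup>2) ^ n = (real n ^ n)\<^sup>2" by (rule trans[OF power_mult[symmetric] power_even_eq])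
  finally show ?thesis .
qed

lemma legendre_dual_le:
  assumes u: "u \<in> C_plus_half" and conv: "log_x2_convex u" and n: "n \<ge> 1"
  shows "legendre (dual_legendre u) (real n)
    \<le> (exp 2) ^ n * (1 / (legendre u (real n) * (fact n)\<^sup>2))"
proof -
  have L: "0 < legendre u (real n)" by (rule legendre_pos[OF u])
  have "fact n \<le> real n ^ n"
    using fact_le_power[of n, where 'a = real] by simp
  then have "(fact n)\<^sup>2 \<le> (real n ^ n)\<^sup>2" by (intro power_mono) auto
  then have "exp 2 ^ n / (real n ^ n)\<^sup>2 \<le> exp 2 ^ n / (fact n)\<^sup>2"
    using n by (intro divide_left_mono) auto
  then have "legendre u (real n) * legendre (dual_legendre u) (real n)
      \<le> exp 2 ^ n / (fact n)\<^sup>2"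
    using legendre_mult_legendre_dual_le[OF u conv n] by linarith
  then show ?thesis using L by (simp add: field_simps)
qed

lemma equivalent_power_series:
  fixes a b :: "nat \<Rightarrow> real"
  assumes sa: "\<And>r. summable (\<lambda>n. a n * r ^ n)" and sb: "\<And>r. summable (\<lambda>n. b n * r ^ n)"
    and b: "\<And>n. 0 < b n" and ba: "\<And>n. b n \<le> a n"
    and ab: "\<And>n. a n \<le> C * q ^ n * b n" and q: "q > 0"
  shows "equivalent_funs (\<lambda>r. \<Sum>n. a n * r ^ n) (\<lambda>r. \<Sum>n. b n * r ^ n)"
proof -
  have a: "0 < a n" for n using b[of n] ba[of n] by linarith
  have "0 < C * q ^ 0 * b 0" by (rule less_le_trans[OF a ab])
  then have C: "C > 0" using b[of 0] by (simp add: zero_less_mult_iff)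
  have pos: "0 < (\<Sum>n. c n * r ^ n)"
    if "\<And>n. 0 < c n" "summable (\<lambda>n. c n * r ^ n)" "r \<ge> 0" for c :: "nat \<Rightarrow> real" and r
    using that by (intro suminf_pos2[of _ 0]) (auto simp: less_imp_le)
  have lower: "1 / C * (\<Sum>n. a n * (1 / q * r) ^ n) \<le> (\<Sum>n. b n * r ^ n)" if r: "r \<ge> 0" for r
  proof -
    have "a n * (1 / q * r) ^ n \<le> C * (b n * r ^ n)" for n
    proof -
      have "a n * (1 / q * r) ^ n \<le> C * q ^ n * b n * (1 / q * r) ^ n"
        using ab[of n] q r by (intro mult_right_mono) auto
      also have "\<dots> = C * (b n * r ^ n)" using q by (simp add: power_divide)
      finally show ?thesis .
    qed
    then have "(\<Sum>n. a n * (1 / q * r) ^ n) \<le> (\<Sum>n. C * (b n * r ^ n))"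
      by (intro suminf_le sa summable_mult sb)
    also have "\<dots> = C * (\<Sum>n. b n * r ^ n)" by (rule suminf_mult[OF sb])
    finally show ?thesis using C by (simp add: field_simps)
  qed
  have upper: "(\<Sum>n. b n * r ^ n) \<le> 1 * (\<Sum>n. a n * (1 * r) ^ n)" if r: "r \<ge> 0" for r
    using r by (simp, intro suminf_le sa sb mult_right_mono ba) auto
  have "\<exists>c1>0. \<exists>c2>0. \<exists>a1>0. \<exists>a2>0. \<forall>r\<ge>0.
      c1 * (\<Sum>n. a n * (a1 * r) ^ n) \<le> (\<Sum>n. b n * r ^ n) \<and>
      (\<Sum>n. b n * r ^ n) \<le> c2 * (\<Sum>n. a n * (a2 * r) ^ n)"
    by (rule exI[of _ "1 / C"], rule conjI, simp add: C,
        rule exI[of _ 1], rule conjI, simp,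
        rule exI[of _ "1 / q"], rule conjI, simp add: q,
        rule exI[of _ 1], rule conjI, simp)
       (use lower upper in blast)
  then show ?thesis unfolding equivalent_funs_def
    using pos[OF a sa] pos[OF b sb] by blast
qed

theorem theorem4p8:
  fixes u :: "real \<Rightarrow> real"
  assumes "u \<in> C_plus_half"
    and "log_x2_convex u"
  shows "equivalent_funs (L_fun (dual_legendre u)) (L_sharp u)"
proof -
  note u = assms(1) and conv = assms(2)
  define a where "a = (\<lambda>n. legendre (dual_legendre u) (real n))"
  define b where "b = (\<lambda>n. 1 / (legendre u (real n) * (fact n)\<^sup>2))"
  have b: "0 < b n" for n using legendre_pos[OF u, of n] by (simp add: b_def)
  \<comment> \<open>The second entry takes care of \<open>n = 0\<close>, where the minimiser of \<open>u\<close> may be the boundary point \<open>0\<close>.\<close>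
  define C where "C = max 1 (a 0 / b 0)"
  have "a n \<le> C * (exp 2) ^ n * b n" for n
  proof (cases "n = 0")
    case True
    have "a 0 / b 0 \<le> C" by (simp add: C_def)
    then show ?thesis using True b[of 0] by (simp add: field_simps)
  next
    case False
    then have "a n \<le> 1 * ((exp 2) ^ n * b n)"
      using legendre_dual_le[OF u conv, of n] by (simp add: a_def b_def)
    also have "\<dots> \<le> C * ((exp 2) ^ n * b n)"
      using b[of n] by (intro mult_right_mono) (auto simp: C_def)
    finally show ?thesis by (simp add: mult.assoc)
  qed
  moreover have "summable (\<lambda>n. a n * r ^ n)" for r
    unfolding a_def by (intro summable_L_fun dual_legendre_pos[OF u])
  moreover have "summable (\<lambda>n. b n * r ^ n)" for r
    unfolding b_def by (rule summable_L_sharp[OF u])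
  moreover have "b n \<le> a n" for n
    unfolding a_def b_def by (rule legendre_dual_ge[OF u])
  ultimately have "equivalent_funs (\<lambda>r. \<Sum>n. a n * r ^ n) (\<lambda>r. \<Sum>n. b n * r ^ n)"
    using b by (intro equivalent_power_series[where C = C and q = "exp 2"]) auto
  then show ?thesis by (simp add: a_def b_def L_fun_def[abs_def] L_sharp_def[abs_def])
qed

end
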